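(* The equations expressing idempotence ($css=cs$, $ctt=ct$), previous redundance ($csts=cts$, $ctst=cst$) and commutativity in the sorts $S^\downarrow$ and $S^\uparrow$ ($csu=cus$, $ctv=cvt$), where $c$ is a variable of sort $C$, $s,u$ are variables of sort $S^\downarrow$ and $t,v$ are variables of sort $S^\uparrow$, axiomatize the equational theory of $\uparrow\downarrow$-biactions. That is, an equation between two terms of the same sort in the three-sorted language of biactions holds universally in all $\uparrow\downarrow$-biactions if and only if it is a consequence of these equations.
   Context: A biaction $(C,S^\downarrow,S^\uparrow)$ consists of three sets and two functions $f\colon C\times S^\downarrow\to C$ and $g\colon C\times S^\uparrow\to C$; write $cs$ for $f(c,s)$ and $ct$ for $g(c,t)$, associating to the left. It is regarded as an algebra in a three-sorted signature with the two function symbols $f,g$. Thus the terms of sorts $S^\downarrow$ and $S^\uparrow$ are single variables, and the terms of sort $C$ are of the form $cx_1\cdots x_n$ ($n\ge0$) with $c$ a variable of sort $C$ and each $x_i$ a variable of sort $S^\downarrow$ or $S^\uparrow$. For a set $X$, the full $\uparrow\downarrow$-biaction $F(X)$ on $X$ has $C=S^\downarrow=S^\uparrow=\mathcal{P}(X)$, with $cs=c\cap s$ for $c\in C$, $s\in S^\downarrow$, and $ct=c\cup t$ for $c\in C$, $t\in S^\uparrow$. A biaction is an $\uparrow\downarrow$-biaction if it is isomorphic to a (three-sorted) subalgebra of $F(X)$ for some set $X$. *)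

theory Defs
  imports Main "HOL-Library.Infinite_Typeclass"
begin

section \<open>Biactions\<close>

text \<open>Each carrier is a possibly empty set in its own type. The values of the operations
  outside the carriers are irrelevant; all notions below look at the carriers only.\<close>

record ('c, 's, 't) biaction =
  points :: "'c set"
  downs :: "'s set"
  ups :: "'t set"
  dact :: "'c \<Rightarrow> 's \<Rightarrow> 'c"
  uact :: "'c \<Rightarrow> 't \<Rightarrow> 'c"

definition is_biaction :: "('c, 's, 't) biaction \<Rightarrow> bool" where
  "is_biaction B \<longleftrightarrow>
     (\<forall>c\<in>points B. \<forall>s\<in>downs B. dact B c s \<in> points B) \<and>
     (\<forall>c\<in>points B. \<forall>t\<in>ups B. uact B c t \<in> points B)"

definition subalgebra :: "('c, 's, 't) biaction \<Rightarrow> ('c, 's, 't) biaction \<Rightarrow> bool" where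
  "subalgebra A B \<longleftrightarrow>
     is_biaction A \<and>
     points A \<subseteq> points B \<and> downs A \<subseteq> downs B \<and> ups A \<subseteq> ups B \<and>
     (\<forall>c\<in>points A. \<forall>s\<in>downs A. dact A c s = dact B c s) \<and>
     (\<forall>c\<in>points A. \<forall>t\<in>ups A. uact A c t = uact B c t)"

definition isomorphic :: "('c, 's, 't) biaction \<Rightarrow> ('c2, 's2, 't2) biaction \<Rightarrow> bool" where
  "isomorphic A B \<longleftrightarrow>
     (\<exists>h i j. bij_betw h (points A) (points B) \<and>
              bij_betw i (downs A) (downs B) \<and>
              bij_betw j (ups A) (ups B) \<and>
              (\<forall>c\<in>points A. \<forall>s\<in>downs A. h (dact A c s) = dact B (h c) (i s)) \<and>
              (\<forall>c\<in>points A. \<forall>t\<in>ups A. h (uact A c t) = uact B (h c) (j t)))"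

definition full_biaction :: "'x set \<Rightarrow> ('x set, 'x set, 'x set) biaction" where
  "full_biaction X =
     \<lparr>points = Pow X, downs = Pow X, ups = Pow X, dact = (\<inter>), uact = (\<union>)\<rparr>"

text \<open>The first argument only supplies the type from which the set \<open>X\<close> is taken. HOL cannot
  quantify over types inside a formula, so ``all biactions'' below means all biactions whose
  carriers are arbitrary subsets of the types \<open>'c\<close>, \<open>'s\<close>, \<open>'t\<close>; these types, and \<open>'x\<close>, are
  themselves arbitrary, except that \<open>'c\<close>, \<open>'s\<close>, \<open>'t\<close> must be infinite (over one-element types
  every biaction would be trivial). Every biaction is isomorphic to one over infinite types.\<close>

definition updown_biaction :: "'x itself \<Rightarrow> ('c, 's, 't) biaction \<Rightarrow> bool" where
  "updown_biaction T B \<longleftrightarrow>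
     is_biaction B \<and>
     (\<exists>(X :: 'x set) A. subalgebra A (full_biaction X) \<and> isomorphic B A)"

section \<open>Terms and equations\<close>

text \<open>Each of the three sorts has its own countable supply of variables, indexed by \<open>nat\<close>; the
  same number used at two different sorts denotes two different variables. The terms of the two
  acting sorts are single variables, hence are represented by their index.\<close>

datatype cterm =
    Var nat
  | Down cterm nat  (infixl "\<cdot>\<^sub>d" 70)
  | Up cterm nat  (infixl "\<cdot>\<^sub>u" 70)

datatype equation = EqC cterm cterm | EqD nat nat | EqU nat nat

fun cvars :: "cterm \<Rightarrow> nat set" where
  "cvars (Var x) = {x}"
| "cvars (p \<cdot>\<^sub>d s) = cvars p"
| "cvars (p \<cdot>\<^sub>u t) = cvars p"

fun dvars :: "cterm \<Rightarrow> nat set" where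
  "dvars (Var x) = {}"
| "dvars (p \<cdot>\<^sub>d s) = insert s (dvars p)"
| "dvars (p \<cdot>\<^sub>u t) = dvars p"

fun uvars :: "cterm \<Rightarrow> nat set" where
  "uvars (Var x) = {}"
| "uvars (p \<cdot>\<^sub>d s) = uvars p"
| "uvars (p \<cdot>\<^sub>u t) = insert t (uvars p)"

fun eval :: "('c, 's, 't) biaction \<Rightarrow> (nat \<Rightarrow> 'c) \<Rightarrow> (nat \<Rightarrow> 's) \<Rightarrow> (nat \<Rightarrow> 't) \<Rightarrow> cterm \<Rightarrow> 'c" where
  "eval B \<alpha> \<beta> \<gamma> (Var x) = \<alpha> x"
| "eval B \<alpha> \<beta> \<gamma> (p \<cdot>\<^sub>d s) = dact B (eval B \<alpha> \<beta> \<gamma> p) (\<beta> s)"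
| "eval B \<alpha> \<beta> \<gamma> (p \<cdot>\<^sub>u t) = uact B (eval B \<alpha> \<beta> \<gamma> p) (\<gamma> t)"

text \<open>Only the variables occurring in the equation are required to take values in the carriers.
  Thus an empty carrier makes an equation vacuously true only if a variable of that sort occurs
  in it.\<close>

fun satisfies :: "('c, 's, 't) biaction \<Rightarrow> equation \<Rightarrow> bool" where
  "satisfies B (EqC p q) \<longleftrightarrow>
     (\<forall>\<alpha> \<beta> \<gamma>. (\<forall>x \<in> cvars p \<union> cvars q. \<alpha> x \<in> points B) \<longrightarrow>
              (\<forall>s \<in> dvars p \<union> dvars q. \<beta> s \<in> downs B) \<longrightarrow>
              (\<forall>t \<in> uvars p \<union> uvars q. \<gamma> t \<in> ups B) \<longrightarrow>
              eval B \<alpha> \<beta> \<gamma> p = eval B \<alpha> \<beta> \<gamma> q)"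
| "satisfies B (EqD s u) \<longleftrightarrow>
     (\<forall>\<beta> :: nat \<Rightarrow> 's. \<beta> s \<in> downs B \<longrightarrow> \<beta> u \<in> downs B \<longrightarrow> \<beta> s = \<beta> u)"
| "satisfies B (EqU t v) \<longleftrightarrow>
     (\<forall>\<gamma> :: nat \<Rightarrow> 't. \<gamma> t \<in> ups B \<longrightarrow> \<gamma> v \<in> ups B \<longrightarrow> \<gamma> t = \<gamma> v)"

section \<open>Consequence\<close>

fun csubst :: "(nat \<Rightarrow> cterm) \<Rightarrow> (nat \<Rightarrow> nat) \<Rightarrow> (nat \<Rightarrow> nat) \<Rightarrow> cterm \<Rightarrow> cterm" where
  "csubst \<sigma> \<delta> \<upsilon> (Var x) = \<sigma> x"
| "csubst \<sigma> \<delta> \<upsilon> (p \<cdot>\<^sub>d s) = csubst \<sigma> \<delta> \<upsilon> p \<cdot>\<^sub>d \<delta> s"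
| "csubst \<sigma> \<delta> \<upsilon> (p \<cdot>\<^sub>u t) = csubst \<sigma> \<delta> \<upsilon> p \<cdot>\<^sub>u \<upsilon> t"

fun esubst :: "(nat \<Rightarrow> cterm) \<Rightarrow> (nat \<Rightarrow> nat) \<Rightarrow> (nat \<Rightarrow> nat) \<Rightarrow> equation \<Rightarrow> equation" where
  "esubst \<sigma> \<delta> \<upsilon> (EqC p q) = EqC (csubst \<sigma> \<delta> \<upsilon> p) (csubst \<sigma> \<delta> \<upsilon> q)"
| "esubst \<sigma> \<delta> \<upsilon> (EqD s u) = EqD (\<delta> s) (\<delta> u)"
| "esubst \<sigma> \<delta> \<upsilon> (EqU t v) = EqU (\<upsilon> t) (\<upsilon> v)"

text \<open>Three-sorted equational logic. For arbitrary \<open>E\<close> the transitivity rules may be unsound in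
  algebras with an empty carrier (the middle term may contain additional variables). This does
  not happen if, as for \<open>updown_axioms\<close> below, both sides of every equation in \<open>E\<close> contain the
  same variables.\<close>

inductive derivable :: "equation set \<Rightarrow> equation \<Rightarrow> bool" for E where
  axiom: "e \<in> E \<Longrightarrow> derivable E e"
| subst: "derivable E e \<Longrightarrow> derivable E (esubst \<sigma> \<delta> \<upsilon> e)"
| reflC: "derivable E (EqC p p)"
| reflD: "derivable E (EqD s s)"
| reflU: "derivable E (EqU t t)"
| symC: "derivable E (EqC p q) \<Longrightarrow> derivable E (EqC q p)"
| symD: "derivable E (EqD s u) \<Longrightarrow> derivable E (EqD u s)"
| symU: "derivable E (EqU t v) \<Longrightarrow> derivable E (EqU v t)"
| transC: "derivable E (EqC p q) \<Longrightarrow> derivable E (EqC q r) \<Longrightarrow> derivable E (EqC p r)"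
| transD: "derivable E (EqD s u) \<Longrightarrow> derivable E (EqD u w) \<Longrightarrow> derivable E (EqD s w)"
| transU: "derivable E (EqU t v) \<Longrightarrow> derivable E (EqU v w) \<Longrightarrow> derivable E (EqU t w)"
| congD: "derivable E (EqC p q) \<Longrightarrow> derivable E (EqD s u) \<Longrightarrow> derivable E (EqC (p \<cdot>\<^sub>d s) (q \<cdot>\<^sub>d u))"
| congU: "derivable E (EqC p q) \<Longrightarrow> derivable E (EqU t v) \<Longrightarrow> derivable E (EqC (p \<cdot>\<^sub>u t) (q \<cdot>\<^sub>u v))"

definition updown_axioms :: "equation set" where
  "updown_axioms =
    (let c = Var 0; s = 0; u = 1; t = 0; v = 1 in
     {EqC (c \<cdot>\<^sub>d s \<cdot>\<^sub>d s) (c \<cdot>\<^sub>d s),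
      EqC (c \<cdot>\<^sub>u t \<cdot>\<^sub>u t) (c \<cdot>\<^sub>u t),
      EqC (c \<cdot>\<^sub>d s \<cdot>\<^sub>u t \<cdot>\<^sub>d s) (c \<cdot>\<^sub>u t \<cdot>\<^sub>d s),
      EqC (c \<cdot>\<^sub>u t \<cdot>\<^sub>d s \<cdot>\<^sub>u t) (c \<cdot>\<^sub>d s \<cdot>\<^sub>u t),
      EqC (c \<cdot>\<^sub>d s \<cdot>\<^sub>d u) (c \<cdot>\<^sub>d u \<cdot>\<^sub>d s),
      EqC (c \<cdot>\<^sub>u t \<cdot>\<^sub>u v) (c \<cdot>\<^sub>u v \<cdot>\<^sub>u t)})"

end

theory Submission
  imports Defs
begin

text \<open>
  Everything reduces to the biaction on the two truth values, with conjunction as downward and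
  disjunction as upward action. Up to isomorphism it is the full biaction on a one-element set, so
  it has a copy over every choice of the types, and an equation valid in all
  \<open>\<up>\<down>\<close>-biactions holds in it.

  In the truth values, a downward letter is either absorbing (value \<open>False\<close>) or neutral (value
  \<open>True\<close>), and dually for an upward letter. The value of a term is therefore decided by its last
  absorbing letter, or by its head variable if there is none. Hence the term function
  determines the head, the set of letters, and the relative order of the last occurrences of any
  downward and any upward letter. The equations allow just enough rewriting to match this:
  all occurrences of a letter except the last can be erased
  (\<open>provable_erase_down\<close>, \<open>provable_erase_up\<close>), and a letter whose last occurrence is followed
  by no letter of the other kind can be moved to the end
  (\<open>provable_move_down\<close>, \<open>provable_move_up\<close>).
  Completeness (\<open>provable_if_bool_equal\<close>) follows by peeling off the last letter of one side,
  moving the same letter to the end of the other side, and erasing it everywhere else: the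
  remaining terms are shorter and still have equal term functions, as one sees by giving the
  erased letter its neutral value.

  For the converse, derivable equations hold in every model of the axioms, empty carriers
  included, because the two sides of a derivable equation contain the same variables. Since the
  \<open>\<up>\<down>\<close>-biactions are models, the three classes of equations coincide.
\<close>

section \<open>The biaction of truth values\<close>

definition bool_biaction :: "(bool, bool, bool) biaction" where
  "bool_biaction = \<lparr>points = UNIV, downs = UNIV, ups = UNIV, dact = (\<and>), uact = (\<or>)\<rparr>"

abbreviation truth :: "(nat \<Rightarrow> bool) \<Rightarrow> (nat \<Rightarrow> bool) \<Rightarrow> (nat \<Rightarrow> bool) \<Rightarrow> cterm \<Rightarrow> bool" where
  "truth \<equiv> eval bool_biaction"

lemma bool_biaction_simps [simp]:
  "dact bool_biaction c s = (c \<and> s)" "uact bool_biaction c t = (c \<or> t)"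
  by (simp_all add: bool_biaction_def)

lemma ex_inj_bool_infinite: "\<exists>f :: bool \<Rightarrow> 'a::infinite. inj f"
proof -
  obtain a b :: 'a where "a \<noteq> b"
    using ex_new_if_finite[OF infinite_UNIV, of "{undefined}"] by auto
  then have "inj (\<lambda>x. if x then a else b)"
    by (auto simp: inj_on_def)
  then show ?thesis
    by (rule exI[of inj])
qed

text \<open>Validity is stated for biactions over three given infinite types. A copy of the biaction of
  truth values has to be placed inside them, along injections \<open>f\<close>, \<open>g\<close>, \<open>h\<close>.\<close>

definition transported_bool_biaction ::
  "(bool \<Rightarrow> 'c) \<Rightarrow> (bool \<Rightarrow> 's) \<Rightarrow> (bool \<Rightarrow> 't) \<Rightarrow> ('c, 's, 't) biaction" where
  "transported_bool_biaction f g h =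
     \<lparr>points = range f, downs = range g, ups = range h,
      dact = (\<lambda>c s. f (inv f c \<and> inv g s)), uact = (\<lambda>c t. f (inv f c \<or> inv h t))\<rparr>"

lemma eval_transported_bool_biaction:
  assumes "inj f" "inj g" "inj h"
  shows "eval (transported_bool_biaction f g h) (f \<circ> \<alpha>) (g \<circ> \<beta>) (h \<circ> \<gamma>) p = f (truth \<alpha> \<beta> \<gamma> p)"
  using assms by (induction p) (simp_all add: transported_bool_biaction_def)

lemma updown_transported_bool_biaction:
  assumes "inj f" "inj g" "inj h"
  shows "updown_biaction TYPE('x) (transported_bool_biaction f g h)"
proof -
  let ?B = "transported_bool_biaction f g h"
  \<comment> \<open>Any one-element set will do.\<close>
  define X :: "'x set" where "X = {undefined}"
  define k where "k b = (if b then X else {})" for b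
  have k: "bij_betw k UNIV (Pow X)"
    by (auto simp: bij_betw_def inj_on_def k_def X_def Pow_insert UNIV_bool)
  have inv: "bij_betw (inv r) (range r) UNIV" if "inj r" for r :: "bool \<Rightarrow> 'z"
    using that by (simp add: bij_betw_inv_into inj_imp_bij_betw_inv)
  have bij: "bij_betw (k \<circ> inv r) (range r) (Pow X)" if "inj r" for r :: "bool \<Rightarrow> 'z"
    using bij_betw_trans[OF inv[OF that] k] .
  have "isomorphic ?B (full_biaction X)"
    unfolding isomorphic_def
  proof (intro exI conjI)
    show "bij_betw (k \<circ> inv f) (points ?B) (points (full_biaction X))"
      using bij[OF assms(1)] by (simp add: transported_bool_biaction_def full_biaction_def)
    show "bij_betw (k \<circ> inv g) (downs ?B) (downs (full_biaction X))"
      using bij[OF assms(2)] by (simp add: transported_bool_biaction_def full_biaction_def)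
    show "bij_betw (k \<circ> inv h) (ups ?B) (ups (full_biaction X))"
      using bij[OF assms(3)] by (simp add: transported_bool_biaction_def full_biaction_def)
  qed (use assms in \<open>auto simp: transported_bool_biaction_def full_biaction_def k_def\<close>)
  moreover have "subalgebra (full_biaction X) (full_biaction X)"
    by (auto simp: subalgebra_def is_biaction_def full_biaction_def)
  moreover have "is_biaction ?B"
    by (auto simp: is_biaction_def transported_bool_biaction_def)
  ultimately show ?thesis
    unfolding updown_biaction_def by blast
qed

lemma satisfies_transported_bool_biaction:
  assumes "inj f" "inj g" "inj h"
  shows "satisfies (transported_bool_biaction f g h) e \<Longrightarrow> satisfies bool_biaction e"
proof (cases e)
  case (EqC p q)
  assume sat: "satisfies (transported_bool_biaction f g h) e"
  have "truth \<alpha> \<beta> \<gamma> p = truth \<alpha> \<beta> \<gamma> q" for \<alpha> \<beta> \<gamma>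
  proof -
    let ?e = "eval (transported_bool_biaction f g h) (f \<circ> \<alpha>) (g \<circ> \<beta>) (h \<circ> \<gamma>)"
    have "?e p = ?e q"
      using sat unfolding EqC satisfies.simps
      by (elim allE[where x = "f \<circ> \<alpha>"] allE[where x = "g \<circ> \<beta>"] allE[where x = "h \<circ> \<gamma>"])
        (simp add: transported_bool_biaction_def)
    then show ?thesis
      using assms by (simp only: eval_transported_bool_biaction inj_eq)
  qed
  then show ?thesis
    by (simp add: EqC)
next
  case (EqD s u)
  assume sat: "satisfies (transported_bool_biaction f g h) e"
  have "\<beta> s = \<beta> u" for \<beta> :: "nat \<Rightarrow> bool"
    using sat assms(2) unfolding EqD satisfies.simps
    by (elim allE[where x = "g \<circ> \<beta>"]) (simp add: transported_bool_biaction_def inj_eq)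
  then show ?thesis
    by (simp add: EqD)
next
  case (EqU t v)
  assume sat: "satisfies (transported_bool_biaction f g h) e"
  have "\<gamma> t = \<gamma> v" for \<gamma> :: "nat \<Rightarrow> bool"
    using sat assms(3) unfolding EqU satisfies.simps
    by (elim allE[where x = "h \<circ> \<gamma>"]) (simp add: transported_bool_biaction_def inj_eq)
  then show ?thesis
    by (simp add: EqU)
qed

lemma satisfies_bool_biaction_if_valid:
  assumes "\<forall>B :: ('c::infinite, 's::infinite, 't::infinite) biaction.
             updown_biaction TYPE('x) B \<longrightarrow> satisfies B e"
  shows "satisfies bool_biaction e"
proof -
  obtain f :: "bool \<Rightarrow> 'c" and g :: "bool \<Rightarrow> 's" and h :: "bool \<Rightarrow> 't"
    where "inj f" "inj g" "inj h"
    using ex_inj_bool_infinite by metis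
  then show ?thesis
    using assms updown_transported_bool_biaction satisfies_transported_bool_biaction by metis
qed

section \<open>Rewriting terms with the axioms\<close>

definition provable :: "cterm \<Rightarrow> cterm \<Rightarrow> bool" (infix "\<approx>" 50) where
  "p \<approx> q \<longleftrightarrow> derivable updown_axioms (EqC p q)"

lemma provable_refl: "p \<approx> p"
  unfolding provable_def by (rule derivable.reflC)

lemma provable_sym: "p \<approx> q \<Longrightarrow> q \<approx> p"
  unfolding provable_def by (rule derivable.symC)

lemma provable_trans [trans]: "p \<approx> q \<Longrightarrow> q \<approx> r \<Longrightarrow> p \<approx> r"
  unfolding provable_def by (rule derivable.transC)

lemma provable_down: "p \<approx> q \<Longrightarrow> p \<cdot>\<^sub>d s \<approx> q \<cdot>\<^sub>d s"
  unfolding provable_def by (intro derivable.congD derivable.reflD)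

lemma provable_up: "p \<approx> q \<Longrightarrow> p \<cdot>\<^sub>u t \<approx> q \<cdot>\<^sub>u t"
  unfolding provable_def by (intro derivable.congU derivable.reflU)

lemma provable_axioms:
  shows down_idem: "p \<cdot>\<^sub>d s \<cdot>\<^sub>d s \<approx> p \<cdot>\<^sub>d s"
    and up_idem: "p \<cdot>\<^sub>u t \<cdot>\<^sub>u t \<approx> p \<cdot>\<^sub>u t"
    and down_redundant: "p \<cdot>\<^sub>d s \<cdot>\<^sub>u t \<cdot>\<^sub>d s \<approx> p \<cdot>\<^sub>u t \<cdot>\<^sub>d s"
    and up_redundant: "p \<cdot>\<^sub>u t \<cdot>\<^sub>d s \<cdot>\<^sub>u t \<approx> p \<cdot>\<^sub>d s \<cdot>\<^sub>u t"
    and down_commute: "p \<cdot>\<^sub>d s \<cdot>\<^sub>d u \<approx> p \<cdot>\<^sub>d u \<cdot>\<^sub>d s"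
    and up_commute: "p \<cdot>\<^sub>u t \<cdot>\<^sub>u v \<approx> p \<cdot>\<^sub>u v \<cdot>\<^sub>u t"
proof -
  \<comment> \<open>The axioms use the variables 0 and 1 only.\<close>
  define inst where "inst =
    csubst (\<lambda>_. p) (\<lambda>n. if n = 0 then s else u) (\<lambda>n. if n = 0 then t else v)"
  have inst: "inst q \<approx> inst r" if "EqC q r \<in> updown_axioms" for q r
    using derivable.subst[OF derivable.axiom[OF that]] by (simp add: provable_def inst_def)
  show "p \<cdot>\<^sub>d s \<cdot>\<^sub>d s \<approx> p \<cdot>\<^sub>d s"
    using inst[of "Var 0 \<cdot>\<^sub>d 0 \<cdot>\<^sub>d 0" "Var 0 \<cdot>\<^sub>d 0"]
    by (simp add: updown_axioms_def Let_def inst_def)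
  show "p \<cdot>\<^sub>u t \<cdot>\<^sub>u t \<approx> p \<cdot>\<^sub>u t"
    using inst[of "Var 0 \<cdot>\<^sub>u 0 \<cdot>\<^sub>u 0" "Var 0 \<cdot>\<^sub>u 0"]
    by (simp add: updown_axioms_def Let_def inst_def)
  show "p \<cdot>\<^sub>d s \<cdot>\<^sub>u t \<cdot>\<^sub>d s \<approx> p \<cdot>\<^sub>u t \<cdot>\<^sub>d s"
    using inst[of "Var 0 \<cdot>\<^sub>d 0 \<cdot>\<^sub>u 0 \<cdot>\<^sub>d 0" "Var 0 \<cdot>\<^sub>u 0 \<cdot>\<^sub>d 0"]
    by (simp add: updown_axioms_def Let_def inst_def)
  show "p \<cdot>\<^sub>u t \<cdot>\<^sub>d s \<cdot>\<^sub>u t \<approx> p \<cdot>\<^sub>d s \<cdot>\<^sub>u t"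
    using inst[of "Var 0 \<cdot>\<^sub>u 0 \<cdot>\<^sub>d 0 \<cdot>\<^sub>u 0" "Var 0 \<cdot>\<^sub>d 0 \<cdot>\<^sub>u 0"]
    by (simp add: updown_axioms_def Let_def inst_def)
  show "p \<cdot>\<^sub>d s \<cdot>\<^sub>d u \<approx> p \<cdot>\<^sub>d u \<cdot>\<^sub>d s"
    using inst[of "Var 0 \<cdot>\<^sub>d 0 \<cdot>\<^sub>d 1" "Var 0 \<cdot>\<^sub>d 1 \<cdot>\<^sub>d 0"]
    by (simp add: updown_axioms_def Let_def inst_def)
  show "p \<cdot>\<^sub>u t \<cdot>\<^sub>u v \<approx> p \<cdot>\<^sub>u v \<cdot>\<^sub>u t"
    using inst[of "Var 0 \<cdot>\<^sub>u 0 \<cdot>\<^sub>u 1" "Var 0 \<cdot>\<^sub>u 1 \<cdot>\<^sub>u 0"]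
    by (simp add: updown_axioms_def Let_def inst_def)
qed

fun erase_down :: "nat \<Rightarrow> cterm \<Rightarrow> cterm" where
  "erase_down s (Var x) = Var x"
| "erase_down s (p \<cdot>\<^sub>d u) = (if u = s then erase_down s p else erase_down s p \<cdot>\<^sub>d u)"
| "erase_down s (p \<cdot>\<^sub>u t) = erase_down s p \<cdot>\<^sub>u t"

fun erase_up :: "nat \<Rightarrow> cterm \<Rightarrow> cterm" where
  "erase_up t (Var x) = Var x"
| "erase_up t (p \<cdot>\<^sub>d s) = erase_up t p \<cdot>\<^sub>d s"
| "erase_up t (p \<cdot>\<^sub>u v) = (if v = t then erase_up t p else erase_up t p \<cdot>\<^sub>u v)"

lemma size_erase_down: "size (erase_down s p) \<le> size p"
  by (induction p) auto

lemma size_erase_up: "size (erase_up t p) \<le> size p"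
  by (induction p) auto

lemma truth_erase_down: "truth \<alpha> \<beta> \<gamma> (erase_down s p) = truth \<alpha> (\<beta>(s := True)) \<gamma> p"
  by (induction p) auto

lemma truth_erase_up: "truth \<alpha> \<beta> \<gamma> (erase_up t p) = truth \<alpha> \<beta> (\<gamma>(t := False)) p"
  by (induction p) auto

text \<open>The final \<open>s\<close> makes all earlier ones redundant, however far away they are: a copy of \<open>s\<close>
  is carried leftwards through the term, by commutativity past a downward letter and by
  previous redundance, read from right to left, past an upward one. It absorbs each \<open>s\<close> that it
  meets, and is then carried back.\<close>

lemma provable_erase_down: "p \<cdot>\<^sub>d s \<approx> erase_down s p \<cdot>\<^sub>d s"
proof (induction p)
  case (Var x)
  show ?case
    by (simp add: provable_refl)
next
  case (Down p u)
  show ?case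
  proof (cases "u = s")
    case True
    have "p \<cdot>\<^sub>d s \<cdot>\<^sub>d s \<approx> p \<cdot>\<^sub>d s"
      by (rule down_idem)
    also note Down.IH
    finally show ?thesis
      using True by simp
  next
    case False
    have "p \<cdot>\<^sub>d u \<cdot>\<^sub>d s \<approx> p \<cdot>\<^sub>d s \<cdot>\<^sub>d u"
      by (rule down_commute)
    also have "\<dots> \<approx> erase_down s p \<cdot>\<^sub>d s \<cdot>\<^sub>d u"
      by (intro provable_down Down.IH)
    also have "\<dots> \<approx> erase_down s p \<cdot>\<^sub>d u \<cdot>\<^sub>d s"
      by (rule down_commute)
    finally show ?thesis
      using False by simp
  qed
next
  case (Up p t)
  have "p \<cdot>\<^sub>u t \<cdot>\<^sub>d s \<approx> p \<cdot>\<^sub>d s \<cdot>\<^sub>u t \<cdot>\<^sub>d s"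
    by (rule provable_sym[OF down_redundant])
  also have "\<dots> \<approx> erase_down s p \<cdot>\<^sub>d s \<cdot>\<^sub>u t \<cdot>\<^sub>d s"
    by (intro provable_down provable_up Up.IH)
  also have "\<dots> \<approx> erase_down s p \<cdot>\<^sub>u t \<cdot>\<^sub>d s"
    by (rule down_redundant)
  finally show ?case
    by simp
qed

lemma provable_erase_up: "p \<cdot>\<^sub>u t \<approx> erase_up t p \<cdot>\<^sub>u t"
proof (induction p)
  case (Var x)
  show ?case
    by (simp add: provable_refl)
next
  case (Up p v)
  show ?case
  proof (cases "v = t")
    case True
    have "p \<cdot>\<^sub>u t \<cdot>\<^sub>u t \<approx> p \<cdot>\<^sub>u t"
      by (rule up_idem)
    also note Up.IH
    finally show ?thesis
      using True by simp
  next
    case False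
    have "p \<cdot>\<^sub>u v \<cdot>\<^sub>u t \<approx> p \<cdot>\<^sub>u t \<cdot>\<^sub>u v"
      by (rule up_commute)
    also have "\<dots> \<approx> erase_up t p \<cdot>\<^sub>u t \<cdot>\<^sub>u v"
      by (intro provable_up Up.IH)
    also have "\<dots> \<approx> erase_up t p \<cdot>\<^sub>u v \<cdot>\<^sub>u t"
      by (rule up_commute)
    finally show ?thesis
      using False by simp
  qed
next
  case (Down p s)
  have "p \<cdot>\<^sub>d s \<cdot>\<^sub>u t \<approx> p \<cdot>\<^sub>u t \<cdot>\<^sub>d s \<cdot>\<^sub>u t"
    by (rule provable_sym[OF up_redundant])
  also have "\<dots> \<approx> erase_up t p \<cdot>\<^sub>u t \<cdot>\<^sub>d s \<cdot>\<^sub>u t"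
    by (intro provable_down provable_up Down.IH)
  also have "\<dots> \<approx> erase_up t p \<cdot>\<^sub>d s \<cdot>\<^sub>u t"
    by (rule up_redundant)
  finally show ?case
    by simp
qed

text \<open>The valuation below makes \<open>s\<close> the only downward letter that can push the value down, and
  every upward letter absorbing. So the value is \<open>False\<close> just in case \<open>s\<close> occurs and no upward
  letter follows its last occurrence, which then commutes to the end.\<close>

lemma provable_move_down:
  assumes "\<not> truth (\<lambda>_. True) (\<lambda>u. u \<noteq> s) (\<lambda>_. True) q"
  shows "q \<approx> erase_down s q \<cdot>\<^sub>d s"
  using assms
proof (induction q)
  case (Down q u)
  show ?case
  proof (cases "u = s")
    case True
    then show ?thesis
      using provable_erase_down by simp
  next
    case False
    then have "q \<approx> erase_down s q \<cdot>\<^sub>d s"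
      using Down by simp
    then have "q \<cdot>\<^sub>d u \<approx> erase_down s q \<cdot>\<^sub>d s \<cdot>\<^sub>d u"
      by (rule provable_down)
    also have "\<dots> \<approx> erase_down s q \<cdot>\<^sub>d u \<cdot>\<^sub>d s"
      by (rule down_commute)
    finally show ?thesis
      using False by simp
  qed
qed simp_all

lemma provable_move_up:
  assumes "truth (\<lambda>_. False) (\<lambda>_. False) (\<lambda>v. v = t) q"
  shows "q \<approx> erase_up t q \<cdot>\<^sub>u t"
  using assms
proof (induction q)
  case (Up q v)
  show ?case
  proof (cases "v = t")
    case True
    then show ?thesis
      using provable_erase_up by simp
  next
    case False
    then have "q \<approx> erase_up t q \<cdot>\<^sub>u t"
      using Up by simp
    then have "q \<cdot>\<^sub>u v \<approx> erase_up t q \<cdot>\<^sub>u t \<cdot>\<^sub>u v"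
      by (rule provable_up)
    also have "\<dots> \<approx> erase_up t q \<cdot>\<^sub>u v \<cdot>\<^sub>u t"
      by (rule up_commute)
    finally show ?thesis
      using False by simp
  qed
qed simp_all

section \<open>Completeness\<close>

text \<open>A letter at the end of \<open>q\<close> could be made to absorb against the value of the head of the
  left-hand side, so there is none.\<close>

lemma eq_Var_if_bool_equal:
  assumes eq: "\<And>\<alpha> \<beta> \<gamma>. \<alpha> x = truth \<alpha> \<beta> \<gamma> q"
  shows "q = Var x"
proof (cases q)
  case (Var y)
  then show ?thesis
    using eq[of "\<lambda>z. z = x"] by simp
next
  case (Down q' s)
  then show ?thesis
    using eq[of "\<lambda>_. True" "\<lambda>_. False"] by simp
next
  case (Up q' t)
  then show ?thesis
    using eq[of "\<lambda>_. False" _ "\<lambda>_. True"] by simp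
qed

text \<open>Terms with the same term function on the truth values agree, up to the axioms, in their last
  letter. Once it is erased everywhere else, giving it its neutral value shows that what
  precedes it also has the same term function on both sides. Erasing may drop many letters at
  once, hence the induction on the size.\<close>

lemma provable_if_bool_equal:
  assumes "\<And>\<alpha> \<beta> \<gamma>. truth \<alpha> \<beta> \<gamma> p = truth \<alpha> \<beta> \<gamma> q"
  shows "p \<approx> q"
  using assms
proof (induction "size p" arbitrary: p q rule: less_induct)
  case less
  show ?case
  proof (cases p)
    case (Var x)
    then have "q = Var x"
      using less.prems by (intro eq_Var_if_bool_equal) simp
    then show ?thesis
      using Var by (simp add: provable_refl)
  next
    case (Down p' s)
    have "\<not> truth (\<lambda>_. True) (\<lambda>u. u \<noteq> s) (\<lambda>_. True) q"
      unfolding less.prems[symmetric] Down by simp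
    then have q: "q \<approx> erase_down s q \<cdot>\<^sub>d s"
      by (rule provable_move_down)
    have "truth \<alpha> \<beta> \<gamma> (erase_down s p') = truth \<alpha> \<beta> \<gamma> (erase_down s q)" for \<alpha> \<beta> \<gamma>
      unfolding truth_erase_down less.prems[symmetric] Down by simp
    moreover have "size (erase_down s p') < size p"
      using size_erase_down[of s p'] Down by simp
    ultimately have "erase_down s p' \<approx> erase_down s q"
      by (intro less.hyps)
    then have "erase_down s p' \<cdot>\<^sub>d s \<approx> erase_down s q \<cdot>\<^sub>d s"
      by (rule provable_down)
    with provable_erase_down[of p' s] have "p \<approx> erase_down s q \<cdot>\<^sub>d s"
      unfolding Down by (rule provable_trans)
    also note provable_sym[OF q]
    finally show ?thesis .
  next
    case (Up p' t)
    have "truth (\<lambda>_. False) (\<lambda>_. False) (\<lambda>v. v = t) q"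
      unfolding less.prems[symmetric] Up by simp
    then have q: "q \<approx> erase_up t q \<cdot>\<^sub>u t"
      by (rule provable_move_up)
    have "truth \<alpha> \<beta> \<gamma> (erase_up t p') = truth \<alpha> \<beta> \<gamma> (erase_up t q)" for \<alpha> \<beta> \<gamma>
      unfolding truth_erase_up less.prems[symmetric] Up by simp
    moreover have "size (erase_up t p') < size p"
      using size_erase_up[of t p'] Up by simp
    ultimately have "erase_up t p' \<approx> erase_up t q"
      by (intro less.hyps)
    then have "erase_up t p' \<cdot>\<^sub>u t \<approx> erase_up t q \<cdot>\<^sub>u t"
      by (rule provable_up)
    with provable_erase_up[of p' t] have "p \<approx> erase_up t q \<cdot>\<^sub>u t"
      unfolding Up by (rule provable_trans)
    also note provable_sym[OF q]
    finally show ?thesis .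
  qed
qed

lemma derivable_if_bool_satisfies:
  assumes "satisfies bool_biaction e"
  shows "derivable updown_axioms e"
proof (cases e)
  case (EqC p q)
  then have "p \<approx> q"
    using assms by (intro provable_if_bool_equal) (simp add: bool_biaction_def)
  then show ?thesis
    by (simp add: EqC provable_def)
next
  case (EqD s u)
  then have "s = u"
    using assms by (auto simp: bool_biaction_def dest: spec[of _ "\<lambda>n. n = s"])
  then show ?thesis
    using EqD by (simp add: derivable.reflD)
next
  case (EqU t v)
  then have "t = v"
    using assms by (auto simp: bool_biaction_def dest: spec[of _ "\<lambda>n. n = t"])
  then show ?thesis
    using EqU by (simp add: derivable.reflU)
qed

section \<open>Soundness\<close>

text \<open>Universal algebra calls an equation regular if both sides contain the same variables; for the
  two acting sorts, whose terms are variables, the sides are then identical.\<close>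

fun regular :: "equation \<Rightarrow> bool" where
  "regular (EqC p q) \<longleftrightarrow> cvars p = cvars q \<and> dvars p = dvars q \<and> uvars p = uvars q"
| "regular (EqD s u) \<longleftrightarrow> s = u"
| "regular (EqU t v) \<longleftrightarrow> t = v"

lemma vars_csubst:
  shows "cvars (csubst \<sigma> \<delta> \<upsilon> p) = (\<Union>x\<in>cvars p. cvars (\<sigma> x))"
    and "dvars (csubst \<sigma> \<delta> \<upsilon> p) = \<delta> ` dvars p \<union> (\<Union>x\<in>cvars p. dvars (\<sigma> x))"
    and "uvars (csubst \<sigma> \<delta> \<upsilon> p) = \<upsilon> ` uvars p \<union> (\<Union>x\<in>cvars p. uvars (\<sigma> x))"
  by (induction p) auto

lemma derivable_regular: "derivable updown_axioms e \<Longrightarrow> regular e"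
proof (induction rule: derivable.induct)
  case (axiom e)
  then show ?case
    by (auto simp: updown_axioms_def Let_def)
next
  case (subst e \<sigma> \<delta> \<upsilon>)
  then show ?case
    by (cases e) (simp_all add: vars_csubst)
qed auto

lemma eval_in_points:
  assumes "is_biaction B"
    and "\<forall>x\<in>cvars p. \<alpha> x \<in> points B" "\<forall>s\<in>dvars p. \<beta> s \<in> downs B" "\<forall>t\<in>uvars p. \<gamma> t \<in> ups B"
  shows "eval B \<alpha> \<beta> \<gamma> p \<in> points B"
  using assms(2-4) by (induction p) (use assms(1) in \<open>auto simp: is_biaction_def\<close>)

lemma eval_csubst:
  "eval B \<alpha> \<beta> \<gamma> (csubst \<sigma> \<delta> \<upsilon> p) = eval B (\<lambda>x. eval B \<alpha> \<beta> \<gamma> (\<sigma> x)) (\<beta> \<circ> \<delta>) (\<gamma> \<circ> \<upsilon>) p"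
  by (induction p) auto

lemma satisfies_esubst:
  assumes "is_biaction B" "satisfies B e"
  shows "satisfies B (esubst \<sigma> \<delta> \<upsilon> e)"
proof (cases e)
  case (EqC p q)
  have "eval B \<alpha> \<beta> \<gamma> (csubst \<sigma> \<delta> \<upsilon> p) = eval B \<alpha> \<beta> \<gamma> (csubst \<sigma> \<delta> \<upsilon> q)"
    if vals: "\<forall>x\<in>cvars (csubst \<sigma> \<delta> \<upsilon> p) \<union> cvars (csubst \<sigma> \<delta> \<upsilon> q). \<alpha> x \<in> points B"
      "\<forall>s\<in>dvars (csubst \<sigma> \<delta> \<upsilon> p) \<union> dvars (csubst \<sigma> \<delta> \<upsilon> q). \<beta> s \<in> downs B"
      "\<forall>t\<in>uvars (csubst \<sigma> \<delta> \<upsilon> p) \<union> uvars (csubst \<sigma> \<delta> \<upsilon> q). \<gamma> t \<in> ups B"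
    for \<alpha> \<beta> \<gamma>
  proof -
    have "\<forall>x\<in>cvars p \<union> cvars q. eval B \<alpha> \<beta> \<gamma> (\<sigma> x) \<in> points B"
      using vals by (intro ballI eval_in_points[OF assms(1)]) (auto simp: vars_csubst)
    moreover have "\<forall>s\<in>dvars p \<union> dvars q. (\<beta> \<circ> \<delta>) s \<in> downs B"
      "\<forall>t\<in>uvars p \<union> uvars q. (\<gamma> \<circ> \<upsilon>) t \<in> ups B"
      using vals(2,3) by (auto simp: vars_csubst)
    ultimately show ?thesis
      unfolding eval_csubst
      by (rule assms(2)[unfolded EqC satisfies.simps, THEN spec, THEN spec, THEN spec,
            THEN mp, THEN mp, THEN mp])
  qed
  then show ?thesis
    unfolding EqC esubst.simps satisfies.simps by blast
next
  case (EqD s u)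
  have "\<beta> (\<delta> s) = \<beta> (\<delta> u)" if "\<beta> (\<delta> s) \<in> downs B" "\<beta> (\<delta> u) \<in> downs B" for \<beta>
    using assms(2) that unfolding EqD satisfies.simps
    by (elim allE[where x = "\<beta> \<circ> \<delta>"]) simp
  then show ?thesis
    by (simp add: EqD)
next
  case (EqU t v)
  have "\<gamma> (\<upsilon> t) = \<gamma> (\<upsilon> v)" if "\<gamma> (\<upsilon> t) \<in> ups B" "\<gamma> (\<upsilon> v) \<in> ups B" for \<gamma>
    using assms(2) that unfolding EqU satisfies.simps
    by (elim allE[where x = "\<gamma> \<circ> \<upsilon>"]) simp
  then show ?thesis
    by (simp add: EqU)
qed

text \<open>Regularity settles the transitivity rules: a valuation of the outer terms in the carriers
  is also one of the middle term, as this has no further variables.\<close>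

lemma satisfies_if_derivable:
  assumes "derivable updown_axioms e" "is_biaction B" "\<forall>a\<in>updown_axioms. satisfies B a"
  shows "satisfies B e"
  using assms(1)
proof (induction rule: derivable.induct)
  case (axiom e)
  then show ?case
    using assms(3) by blast
next
  case (subst e \<sigma> \<delta> \<upsilon>)
  then show ?case
    using satisfies_esubst[OF assms(2)] by blast
next
  case (symC p q)
  then show ?case
    by (simp add: Un_commute)
next
  case (transC p q r)
  then show ?case
    using derivable_regular[OF transC.hyps(1)] derivable_regular[OF transC.hyps(2)]
    by simp
next
  case (transD s u w)
  then show ?case
    using derivable_regular[OF transD.hyps(1)] by simp
next
  case (transU t v w)
  then show ?case
    using derivable_regular[OF transU.hyps(1)] by simp
next
  case (congD p q s u)
  then show ?case
    using derivable_regular[OF congD.hyps(2)] by simp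
next
  case (congU p q t v)
  then show ?case
    using derivable_regular[OF congU.hyps(2)] by simp
qed (simp_all, metis+)

lemma updown_biaction_embedding:
  fixes B :: "('c, 's, 't) biaction"
  assumes "updown_biaction TYPE('x) B"
  obtains h :: "'c \<Rightarrow> 'x set" and i j
  where "inj_on h (points B)"
    "\<And>c s. c \<in> points B \<Longrightarrow> s \<in> downs B \<Longrightarrow> h (dact B c s) = h c \<inter> i s"
    "\<And>c t. c \<in> points B \<Longrightarrow> t \<in> ups B \<Longrightarrow> h (uact B c t) = h c \<union> j t"
proof -
  obtain X :: "'x set" and A where A: "subalgebra A (full_biaction X)" "isomorphic B A"
    using assms unfolding updown_biaction_def by blast
  from A(2) obtain h i j where bij: "bij_betw h (points B) (points A)"
    "bij_betw i (downs B) (downs A)" "bij_betw j (ups B) (ups A)"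
    and hom: "\<forall>c\<in>points B. \<forall>s\<in>downs B. h (dact B c s) = dact A (h c) (i s)"
      "\<forall>c\<in>points B. \<forall>t\<in>ups B. h (uact B c t) = uact A (h c) (j t)"
    unfolding isomorphic_def by blast
  show thesis
  proof (rule that)
    show "inj_on h (points B)"
      using bij(1) by (rule bij_betw_imp_inj_on)
    show "h (dact B c s) = h c \<inter> i s" if "c \<in> points B" "s \<in> downs B" for c s
      using A(1) hom(1) that bij_betwE[OF bij(1)] bij_betwE[OF bij(2)]
      by (simp add: subalgebra_def full_biaction_def)
    show "h (uact B c t) = h c \<union> j t" if "c \<in> points B" "t \<in> ups B" for c t
      using A(1) hom(2) that bij_betwE[OF bij(1)] bij_betwE[OF bij(3)]
      by (simp add: subalgebra_def full_biaction_def)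
  qed
qed

lemma updown_biaction_satisfies_axioms:
  assumes "updown_biaction TYPE('x) B" "a \<in> updown_axioms"
  shows "satisfies B a"
proof -
  have [simp]: "dact B c s \<in> points B" if "c \<in> points B" "s \<in> downs B" for c s
    using assms(1) that by (simp add: updown_biaction_def is_biaction_def)
  have [simp]: "uact B c t \<in> points B" if "c \<in> points B" "t \<in> ups B" for c t
    using assms(1) that by (simp add: updown_biaction_def is_biaction_def)
  obtain h :: "_ \<Rightarrow> 'x set" and i j where inj: "inj_on h (points B)"
    and [simp]: "\<And>c s. c \<in> points B \<Longrightarrow> s \<in> downs B \<Longrightarrow> h (dact B c s) = h c \<inter> i s"
      "\<And>c t. c \<in> points B \<Longrightarrow> t \<in> ups B \<Longrightarrow> h (uact B c t) = h c \<union> j t"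
    using updown_biaction_embedding[OF assms(1)] by metis
  show ?thesis
    using assms(2) unfolding updown_axioms_def Let_def
    by (auto intro!: inj_onD[OF inj])
qed

section \<open>The equational theory of \<open>\<up>\<down>\<close>-biactions\<close>

theorem proposition5p1:
  fixes e :: equation
  shows "((\<forall>B :: ('c::infinite, 's::infinite, 't::infinite) biaction.
             updown_biaction TYPE('x) B \<longrightarrow> satisfies B e)
          \<longleftrightarrow> derivable updown_axioms e)
       \<and> ((\<forall>B :: ('c, 's, 't) biaction.
             updown_biaction TYPE('x) B \<longrightarrow> satisfies B e)
          \<longleftrightarrow> (\<forall>B :: ('c, 's, 't) biaction.
             is_biaction B \<longrightarrow> (\<forall>a\<in>updown_axioms. satisfies B a) \<longrightarrow> satisfies B e))"
proof -
  let ?valid = "\<forall>B :: ('c, 's, 't) biaction. updown_biaction TYPE('x) B \<longrightarrow> satisfies B e"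
  let ?conseq = "\<forall>B :: ('c, 's, 't) biaction.
      is_biaction B \<longrightarrow> (\<forall>a\<in>updown_axioms. satisfies B a) \<longrightarrow> satisfies B e"
  have "?valid \<Longrightarrow> derivable updown_axioms e"
    by (intro derivable_if_bool_satisfies satisfies_bool_biaction_if_valid)
  moreover have "derivable updown_axioms e \<Longrightarrow> ?conseq"
    using satisfies_if_derivable by blast
  moreover have "?conseq \<Longrightarrow> ?valid"
    using updown_biaction_satisfies_axioms updown_biaction_def by blast
  ultimately show ?thesis
    by blast
qed

end
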